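(* Let $d\ge 2$ and let $P$ be the $d$-dimensional cross-polytope, with $n=2d$ vertices and $m=2^d$ facets. Let $I^z=\{(i,j):\text{vertex } i \text{ lies on facet } j\}$ and set $\lambda_{ij}=1$ for all $(i,j)\notin I^z$. Then the semidefinite program $$\min_X\ \mathrm{tr}(X)-\sum_{(i,j)\notin I^z}\lambda_{ij}S_{ij}\quad\text{s.t.}\quad X=\begin{bmatrix}1 & \mathbb{1}_n^\top & \mathbb{1}_m^\top\\ \mathbb{1}_n & A & S\\ \mathbb{1}_m & S^\top & B\end{bmatrix}\succeq 0,\ \ S_{ij}=0 \text{ for }(i,j)\in I^z,\ \ A_{ii}=2\ (i=1,\ldots,n)$$ has an optimal solution $X$ of rank $d+1$ whose block $S$ satisfies $S_{ij}>0$ for all $(i,j)\notin I^z$; such a solution certifies the inscribability of the $d$-cross-polytope.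
   Context: A polytope is inscribable if some combinatorially equivalent polytope has all its vertices on a sphere. In the program, $A$ ($n\times n$) and $B$ ($m\times m$) are symmetric and $S$ is $n\times m$, all real; $\mathbb{1}_k$ is the all-ones vector. By the paper's characterization, a $d$-polytope is inscribable iff there is such a positive semidefinite $X$ of rank $d+1$ with constant diagonal in $A$, $S\ge 0$, and $S$ having exactly the zero pattern $I^z$. *)

theory Defs
  imports "HOL-Analysis.Analysis"
begin

definition cross_polytope :: "(real^'d) set" where
  "cross_polytope = convex hull (range (\<lambda>k. axis k 1) \<union> range (\<lambda>k. - axis k 1))"

definition face_lattice_iso ::
    "((real^'d) set \<Rightarrow> (real^'d) set) \<Rightarrow> (real^'d) set \<Rightarrow> (real^'d) set \<Rightarrow> bool" where
  "face_lattice_iso \<phi> P Q \<longleftrightarrow>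
     bij_betw \<phi> {F. F face_of P} {G. G face_of Q} \<and>
     (\<forall>F G. F face_of P \<longrightarrow> G face_of P \<longrightarrow> (F \<subseteq> G \<longleftrightarrow> \<phi> F \<subseteq> \<phi> G))"

definition combinatorially_equivalent :: "(real^'d) set \<Rightarrow> (real^'d) set \<Rightarrow> bool" where
  "combinatorially_equivalent P Q \<longleftrightarrow> (\<exists>\<phi>. face_lattice_iso \<phi> P Q)"

definition inscribed :: "(real^'d) set \<Rightarrow> bool" where
  "inscribed Q \<longleftrightarrow> (\<exists>c r. 0 < r \<and> {x. x extreme_point_of Q} \<subseteq> sphere c r)"

(* For a full-dimensional P, looking for Q in the same space is no restriction:
   combinatorially equivalent polytopes have the same dimension. *)
definition inscribable :: "(real^'d) set \<Rightarrow> bool" where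
  "inscribable P \<longleftrightarrow> (\<exists>Q. polytope Q \<and> combinatorially_equivalent P Q \<and> inscribed Q)"

definition psd :: "real^'k^'k \<Rightarrow> bool" where
  "psd M \<longleftrightarrow> transpose M = M \<and> (\<forall>x. 0 \<le> x \<bullet> (M *v x))"

(* None indexes the leading row and column of ones. *)
fun sdp_entry ::
    "real^'n^'n \<Rightarrow> real^'m^'n \<Rightarrow> real^'m^'m \<Rightarrow> ('n + 'm) option \<Rightarrow> ('n + 'm) option \<Rightarrow> real" where
  "sdp_entry A S B None q = 1"
| "sdp_entry A S B (Some p) None = 1"
| "sdp_entry A S B (Some (Inl i)) (Some (Inl i')) = A $ i $ i'"
| "sdp_entry A S B (Some (Inl i)) (Some (Inr j)) = S $ i $ j"
| "sdp_entry A S B (Some (Inr j)) (Some (Inl i)) = transpose S $ j $ i"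
| "sdp_entry A S B (Some (Inr j)) (Some (Inr j')) = B $ j $ j'"

definition sdp_matrix ::
    "real^'n^'n \<Rightarrow> real^'m^'n \<Rightarrow> real^'m^'m \<Rightarrow> real^(('n + 'm) option)^(('n + 'm) option)" where
  "sdp_matrix A S B = (\<chi> p q. sdp_entry A S B p q)"

definition sdp_feasible ::
    "('n \<times> 'm) set \<Rightarrow> real^'n^'n \<Rightarrow> real^'m^'n \<Rightarrow> real^'m^'m \<Rightarrow> bool" where
  "sdp_feasible Iz A S B \<longleftrightarrow>
     transpose A = A \<and> transpose B = B \<and>
     psd (sdp_matrix A S B) \<and>
     (\<forall>(i, j) \<in> Iz. S $ i $ j = 0) \<and>
     (\<forall>i. A $ i $ i = 2)"

definition sdp_objective ::
    "('n \<times> 'm) set \<Rightarrow> ('n \<Rightarrow> 'm \<Rightarrow> real) \<Rightarrow> real^'n^'n \<Rightarrow> real^'m^'n \<Rightarrow> real^'m^'m \<Rightarrow> real" where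
  "sdp_objective Iz lam A S B =
     trace (sdp_matrix A S B) - (\<Sum>(i, j) \<in> - Iz. lam i j * S $ i $ j)"

definition sdp_optimal ::
    "('n \<times> 'm) set \<Rightarrow> ('n \<Rightarrow> 'm \<Rightarrow> real) \<Rightarrow> real^'n^'n \<Rightarrow> real^'m^'n \<Rightarrow> real^'m^'m \<Rightarrow> bool" where
  "sdp_optimal Iz lam A S B \<longleftrightarrow>
     sdp_feasible Iz A S B \<and>
     (\<forall>A' S' B'. sdp_feasible Iz A' S' B' \<longrightarrow>
        sdp_objective Iz lam A S B \<le> sdp_objective Iz lam A' S' B')"

(* The sdp matrix is the Gram matrix of the vectors (1,0), (1, y i) and (1, - a j), where
   the y i are the vertices of an inscribed realization Q of P and the a j \<bullet> x \<le> 1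
   are its facet inequalities; in particular S is a slack matrix of Q. The isomorphism
   \<phi> matches the labelled vertices v i and facets F j of P with those of Q. *)
definition certifies_inscribability ::
    "(real^'d) set \<Rightarrow> ('n \<Rightarrow> real^'d) \<Rightarrow> ('m \<Rightarrow> (real^'d) set) \<Rightarrow>
     real^'n^'n \<Rightarrow> real^'m^'n \<Rightarrow> real^'m^'m \<Rightarrow> bool" where
  "certifies_inscribability P v F A S B \<longleftrightarrow>
     (\<exists>Q \<phi> y a.
        polytope Q \<and> face_lattice_iso \<phi> P Q \<and> inscribed Q \<and>
        (\<forall>i. \<phi> {v i} = {y i}) \<and>
        (\<forall>j. (\<forall>x\<in>Q. a j \<bullet> x \<le> 1) \<and> \<phi> (F j) = {x \<in> Q. a j \<bullet> x = 1}) \<and>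
        (\<forall>i i'. A $ i $ i' = 1 + y i \<bullet> y i') \<and>
        (\<forall>i j. S $ i $ j = 1 - y i \<bullet> a j) \<and>
        (\<forall>j j'. B $ j $ j' = 1 + a j \<bullet> a j'))"

end

theory Submission
  imports Defs
begin

text \<open>
  The facets of the cross-polytope are cut out by $s \cdot x = 1$ for the sign vectors $s$. View a
  feasible matrix as the Gram matrix of vectors $u$, $w_i$, $z_j$, write $w_k^+$, $w_k^-$ for the
  vectors of an antipodal pair of vertices, and put $y_k = (w_k^+ - w_k^-)/2$. Completing the
  square in each $z_j$, summing over all sign vectors $a_j$ and using the parallelogram law for
  $w_k^+$, $w_k^-$ shows that the objective value equals
  \[ 1 + 2n + m(1 - d) + \sum_j |z_j - u + \sum_k a_{jk} y_k|^2 + m \sum_k |(w_k^+ + w_k^-)/2 - u|^2. \]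
  Hence the minimum is attained exactly when all these squares vanish. The conditions $S_{ij} = 0$
  then force the $y_k$ to be orthonormal, so the optimal matrix is unique: it is the Gram matrix
  of $(1, 0)$, $(1, v_i)$, $(1, -a_j)$, realizing the regular cross-polytope itself.
\<close>

section \<open>Faces of the cross-polytope\<close>

definition sign_vectors :: "(real^'d) set" where
  "sign_vectors = {s. \<forall>k. \<bar>s $ k\<bar> = 1}"

lemma sign_vectors_sq:
  assumes "s \<in> sign_vectors"
  shows "s $ k * s $ k = 1"
  using assms abs_mult_self_eq[of "s $ k"] by (simp add: sign_vectors_def)

lemma sign_vectors_cases:
  assumes "s \<in> sign_vectors"
  shows "s $ k = 1 \<or> s $ k = -1"
  using assms abs_eq_iff'[of "s $ k" 1] by (simp add: sign_vectors_def)

lemma sum_UNIV_option: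
  fixes f :: "'a::finite option \<Rightarrow> 'b::comm_monoid_add"
  shows "(\<Sum>p\<in>UNIV. f p) = f None + (\<Sum>k\<in>UNIV. f (Some k))"
  by (simp add: UNIV_option_conv sum.reindex)

lemma sum_UNIV_sum:
  fixes f :: "'a::finite + 'b::finite \<Rightarrow> 'c::comm_monoid_add"
  shows "(\<Sum>p\<in>UNIV. f p) = (\<Sum>i\<in>UNIV. f (Inl i)) + (\<Sum>j\<in>UNIV. f (Inr j))"
  by (simp add: UNIV_Plus_UNIV[symmetric] sum.Plus del: UNIV_Plus_UNIV)

text \<open>Encodes sign vectors as subsets of the coordinates, which yields their finiteness and
  number.\<close>

definition sign_vector :: "'d set \<Rightarrow> real^'d" where
  "sign_vector K = (\<chi> k. if k \<in> K then 1 else -1)"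

lemma bij_betw_sign_vector: "bij_betw sign_vector UNIV (sign_vectors :: (real^'d::finite) set)"
  unfolding bij_betw_def
proof
  show "inj (sign_vector :: 'd set \<Rightarrow> _)"
    by (auto simp: inj_on_def sign_vector_def vec_eq_iff split: if_splits)
  have "s \<in> range sign_vector" if "s \<in> sign_vectors" for s :: "real^'d"
  proof -
    have "s $ k = 1 \<or> s $ k = -1" for k
      using that by (rule sign_vectors_cases)
    then have "s = sign_vector {k. s $ k = 1}"
      by (auto simp: sign_vector_def vec_eq_iff)
    then show ?thesis by blast
  qed
  then show "range sign_vector = (sign_vectors :: (real^'d) set)"
    by (auto simp: sign_vector_def sign_vectors_def)
qed

lemma finite_sign_vectors: "finite (sign_vectors :: (real^'d::finite) set)"
  using bij_betw_finite[OF bij_betw_sign_vector] by simp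

lemma card_sign_vectors: "card (sign_vectors :: (real^'d::finite) set) = 2 ^ CARD('d)"
  using bij_betw_same_card[OF bij_betw_sign_vector[where 'd = 'd]] card_Pow[of "UNIV :: 'd set"]
  by simp

text \<open>For \<open>k \<noteq> l\<close>, negating coordinate \<open>k\<close> is an involution
  on the sign vectors that reverses each summand, so the sum equals its own negative.\<close>

lemma sum_sign_vectors_orthogonal:
  fixes k l :: "'d::finite"
  shows "(\<Sum>s\<in>sign_vectors. s $ k * s $ l) = (if k = l then 2 ^ CARD('d) else 0)"
proof (cases "k = l")
  case True
  then show ?thesis by (simp add: sign_vectors_sq card_sign_vectors)
next
  case False
  let ?flip = "\<lambda>s :: real^'d. \<chi> i. if i = k then - s $ i else s $ i"
  have "(\<Sum>s\<in>sign_vectors. s $ k * s $ l) = (\<Sum>s\<in>sign_vectors. - (s $ k * s $ l))"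
    by (rule sum.reindex_bij_witness[where i = ?flip and j = ?flip])
      (use False in \<open>auto simp: sign_vectors_def vec_eq_iff\<close>)
  then show ?thesis using False by (simp add: sum_negf)
qed

section \<open>The cross-polytope as l1 ball and as intersection of half-spaces\<close>

lemma inner_le_sum_abs:
  fixes s x :: "real^'d::finite"
  assumes "s \<in> sign_vectors"
  shows "s \<bullet> x \<le> (\<Sum>k\<in>UNIV. \<bar>x $ k\<bar>)"
  unfolding inner_vec_def
proof (rule sum_mono)
  fix k
  have "s $ k * x $ k \<le> \<bar>s $ k * x $ k\<bar>" by simp
  then show "s $ k \<bullet> x $ k \<le> \<bar>x $ k\<bar>"
    using assms by (simp add: abs_mult sign_vectors_def)
qed

lemma convex_cross_polytope: "convex cross_polytope"
  by (simp add: cross_polytope_def)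

lemma zero_in_cross_polytope: "0 \<in> (cross_polytope :: (real^'d::finite) set)"
proof -
  let ?e = "axis undefined 1 :: real^'d"
  have "?e \<in> cross_polytope" "- ?e \<in> cross_polytope"
    by (auto simp: cross_polytope_def intro!: hull_inc)
  from convexD[OF convex_cross_polytope this, of "1/2" "1/2"] show ?thesis by simp
qed

lemma cross_polytope_l1: "cross_polytope = {x :: real^'d::finite. (\<Sum>k\<in>UNIV. \<bar>x $ k\<bar>) \<le> 1}"
proof
  have "convex {x :: real^'d. (\<Sum>k\<in>UNIV. \<bar>x $ k\<bar>) \<le> 1}"
  proof (rule convexI)
    fix x y :: "real^'d" and u v :: real
    assume "x \<in> {x. (\<Sum>k\<in>UNIV. \<bar>x $ k\<bar>) \<le> 1}" "y \<in> {x. (\<Sum>k\<in>UNIV. \<bar>x $ k\<bar>) \<le> 1}"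
      and uv: "0 \<le> u" "0 \<le> v" "u + v = 1"
    then have le: "u * (\<Sum>k\<in>UNIV. \<bar>x $ k\<bar>) + v * (\<Sum>k\<in>UNIV. \<bar>y $ k\<bar>) \<le> 1"
      using convex_bound_le by auto
    have "(\<Sum>k\<in>UNIV. \<bar>(u *\<^sub>R x + v *\<^sub>R y) $ k\<bar>)
        \<le> (\<Sum>k\<in>UNIV. u * \<bar>x $ k\<bar> + v * \<bar>y $ k\<bar>)"
    proof (rule sum_mono)
      fix k
      show "\<bar>(u *\<^sub>R x + v *\<^sub>R y) $ k\<bar> \<le> u * \<bar>x $ k\<bar> + v * \<bar>y $ k\<bar>"
        using abs_triangle_ineq[of "u * x $ k" "v * y $ k"] uv by (simp add: abs_mult)
    qed
    with le show "u *\<^sub>R x + v *\<^sub>R y \<in> {x. (\<Sum>k\<in>UNIV. \<bar>x $ k\<bar>) \<le> 1}"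
      by (simp add: sum.distrib sum_distrib_left)
  qed
  then show "cross_polytope \<subseteq> {x :: real^'d. (\<Sum>k\<in>UNIV. \<bar>x $ k\<bar>) \<le> 1}"
    unfolding cross_polytope_def
    by (intro hull_minimal) (auto simp: axis_def if_distrib cong: if_cong)
next
  show "{x :: real^'d. (\<Sum>k\<in>UNIV. \<bar>x $ k\<bar>) \<le> 1} \<subseteq> cross_polytope"
  proof clarify
    fix x :: "real^'d" assume le: "(\<Sum>k\<in>UNIV. \<bar>x $ k\<bar>) \<le> 1"
    \<comment> \<open>\<open>x\<close> becomes a convex combination of signed basis vectors with
      weights |x_k|; \<open>None\<close> gives the leftover weight to the origin.\<close>
    define c where "c = case_option (1 - (\<Sum>k\<in>UNIV. \<bar>x $ k\<bar>)) (\<lambda>k. \<bar>x $ k\<bar>)"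
    define y where "y = case_option 0 (\<lambda>k. if 0 \<le> x $ k then axis k 1 else - axis k 1 :: real^'d)"
    have "(\<Sum>p\<in>UNIV. c p *\<^sub>R y p) \<in> cross_polytope"
    proof (rule convex_sum[OF _ convex_cross_polytope])
      show "sum c UNIV = 1" by (simp add: sum_UNIV_option c_def)
      show "0 \<le> c p" for p using le by (simp add: c_def split: option.split)
      show "y p \<in> cross_polytope" for p
        using zero_in_cross_polytope
        by (auto simp: y_def cross_polytope_def hull_inc split: option.split)
    qed simp
    moreover have "(\<Sum>p\<in>UNIV. c p *\<^sub>R y p) = (\<Sum>k\<in>UNIV. x $ k *\<^sub>R axis k 1)"
      by (auto simp: sum_UNIV_option c_def y_def intro!: sum.cong)
    ultimately show "x \<in> cross_polytope"
      by (simp add: basis_expansion scalar_mult_eq_scaleR[symmetric])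
  qed
qed

lemma mem_cross_polytope:
  fixes x :: "real^'d::finite"
  shows "x \<in> cross_polytope \<longleftrightarrow> (\<forall>s\<in>sign_vectors. s \<bullet> x \<le> 1)"
proof
  assume "x \<in> cross_polytope"
  then show "\<forall>s\<in>sign_vectors. s \<bullet> x \<le> 1"
    using inner_le_sum_abs order_trans by (fastforce simp: cross_polytope_l1)
next
  assume *: "\<forall>s\<in>sign_vectors. s \<bullet> x \<le> 1"
  \<comment> \<open>The sign pattern of \<open>x\<close> turns the inner product into the l1 norm,
    so its inequality alone is enough.\<close>
  define s :: "real^'d" where "s = (\<chi> k. if 0 \<le> x $ k then 1 else -1)"
  have "s \<in> sign_vectors" by (simp add: s_def sign_vectors_def)
  moreover have "s \<bullet> x = (\<Sum>k\<in>UNIV. \<bar>x $ k\<bar>)"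
    unfolding inner_vec_def by (intro sum.cong) (auto simp: s_def)
  ultimately show "x \<in> cross_polytope" using * by (auto simp: cross_polytope_l1)
qed

section \<open>Vertices and facets\<close>

lemma cross_polytope_subset_cball: "cross_polytope \<subseteq> (cball 0 1 :: (real^'d::finite) set)"
proof -
  have "convex hull (range (\<lambda>k. axis k 1) \<union> range (\<lambda>k. - axis k 1)) \<subseteq> (cball 0 1 :: (real^'d) set)"
    by (intro hull_minimal) auto
  then show ?thesis by (simp add: cross_polytope_def)
qed

text \<open>The generators have norm 1 and the polytope lies in the unit ball, whose strict
  convexity keeps them off every open segment.\<close>

lemma extreme_points_cross_polytope:
  "{x :: real^'d::finite. x extreme_point_of cross_polytope}
     = range (\<lambda>k. axis k 1) \<union> range (\<lambda>k. - axis k 1)" (is "_ = ?V")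
proof
  show "{x. x extreme_point_of cross_polytope} \<subseteq> ?V"
    unfolding cross_polytope_def by (rule extreme_points_of_convex_hull)
next
  have "x extreme_point_of cross_polytope" if "x \<in> ?V" for x
    unfolding extreme_point_of_def
  proof (intro conjI ballI notI)
    show "x \<in> cross_polytope"
      using that by (auto simp: cross_polytope_def hull_inc)
    fix a b assume ab: "a \<in> cross_polytope" "b \<in> cross_polytope" and "x \<in> open_segment a b"
    then have "norm x < norm a \<or> norm x < norm b"
      using dist_decreases_open_segment[of x a b 0] by simp
    moreover have "norm x = 1" using that by auto
    moreover have "norm a \<le> 1" "norm b \<le> 1" using ab cross_polytope_subset_cball by auto
    ultimately show False by simp
  qed
  then show "?V \<subseteq> {x. x extreme_point_of cross_polytope}" by blast
qed

text \<open>The point is \<open>s\<close> scaled by 1/(d-1): s has inner product d with itself, but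
  at most d-2 with any other sign vector. The assumption d \<ge> 2 makes the factor
  positive.\<close>

lemma cross_polytope_irredundant:
  fixes s :: "real^'d::finite"
  assumes "2 \<le> CARD('d)" and s: "s \<in> sign_vectors"
  obtains x where "1 < s \<bullet> x" "\<And>t. t \<in> sign_vectors \<Longrightarrow> t \<noteq> s \<Longrightarrow> t \<bullet> x \<le> 1"
proof
  let ?d = "real CARD('d)"
  let ?x = "(1 / (?d - 1)) *\<^sub>R s"
  have d: "2 \<le> ?d" using assms by simp
  have "s \<bullet> s = ?d" by (simp add: inner_vec_def sign_vectors_sq[OF s])
  then show "1 < s \<bullet> ?x" using d by simp
  fix t assume t: "t \<in> sign_vectors" and "t \<noteq> s"
  then obtain k where k: "t $ k \<noteq> s $ k" by (auto simp: vec_eq_iff)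
  have pm: "t $ l * s $ l \<le> 1" for l
    using sign_vectors_cases[OF s, of l] sign_vectors_cases[OF t, of l] by auto
  have "t $ k * s $ k = -1"
    using sign_vectors_cases[OF s, of k] sign_vectors_cases[OF t, of k] k by auto
  then have "t \<bullet> s = -1 + (\<Sum>l\<in>UNIV - {k}. t $ l * s $ l)"
    by (simp add: inner_vec_def sum.remove[of UNIV k])
  also have "\<dots> \<le> -1 + (\<Sum>l\<in>UNIV - {k}. 1)"
    by (intro add_left_mono sum_mono pm)
  also have "\<dots> \<le> ?d - 1" by simp
  finally show "t \<bullet> ?x \<le> 1" using d by (simp add: divide_simps)
qed

lemma affine_hull_cross_polytope: "affine hull cross_polytope = (UNIV :: (real^'d::finite) set)"
proof -
  have "x \<in> span cross_polytope" for x :: "real^'d"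
  proof -
    have "(\<Sum>k\<in>UNIV. x $ k *\<^sub>R axis k 1) \<in> span cross_polytope"
      by (intro span_sum span_scale span_base) (auto simp: cross_polytope_def hull_inc)
    then show ?thesis by (simp add: basis_expansion scalar_mult_eq_scaleR[symmetric])
  qed
  then show ?thesis
    using affine_hull_span_0[OF hull_inc[OF zero_in_cross_polytope]] by auto
qed

text \<open>In an irredundant description of a full-dimensional polyhedron by half-spaces, the
  facets are exactly the sets where one inequality is tight.\<close>

lemma facets_cross_polytope:
  assumes d: "2 \<le> CARD('d::finite)"
  shows "bij_betw (\<lambda>s. {x \<in> cross_polytope. s \<bullet> x = 1}) sign_vectors
           {G :: (real^'d) set. G facet_of cross_polytope}"
proof -
  let ?S = "sign_vectors :: (real^'d) set"
  let ?P = "cross_polytope :: (real^'d) set"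
  define h where "h = (\<lambda>s :: real^'d. {x. s \<bullet> x \<le> 1})"
  have "s = t" if "h s = h t" "s \<in> ?S" "t \<in> ?S" for s t
  proof (rule ccontr)
    assume "s \<noteq> t"
    with cross_polytope_irredundant[OF d that(2)] that(3)
    obtain x where "1 < s \<bullet> x" "t \<bullet> x \<le> 1" by metis
    then show False using that(1) unfolding h_def by (metis mem_Collect_eq not_less)
  qed
  then have inj: "inj_on h ?S" by (auto simp: inj_on_def)
  \<comment> \<open>\<open>facet_of_polyhedron_explicit\<close> indexes by half-spaces, so the
    normal must be recovered from the half-space; injectivity of \<open>h\<close> makes this
    possible.\<close>
  let ?a = "inv_into ?S h"
  have a_h: "?a (h s) = s" if "s \<in> ?S" for s using inj that by simp
  have aff: "affine hull ?P = UNIV" by (rule affine_hull_cross_polytope)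
  have Pimg: "?P = affine hull ?P \<inter> \<Inter> (h ` ?S)"
    unfolding aff by (auto simp: h_def mem_cross_polytope)
  have halfspace: "?a H \<noteq> 0 \<and> H = {x. ?a H \<bullet> x \<le> 1}" if H: "H \<in> h ` ?S" for H
  proof -
    obtain s where s: "s \<in> ?S" "H = h s" using H by blast
    then have "s \<noteq> 0" by (auto simp: sign_vectors_def)
    then show ?thesis using s a_h by (simp add: h_def)
  qed
  have drop: "?P \<subset> affine hull ?P \<inter> \<Inter> F'" if F': "F' \<subset> h ` ?S" for F'
  proof -
    obtain s where s: "s \<in> ?S" "h s \<notin> F'" using F' by auto
    then obtain x where x: "1 < s \<bullet> x" "\<And>t. t \<in> ?S \<Longrightarrow> t \<noteq> s \<Longrightarrow> t \<bullet> x \<le> 1"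
      using cross_polytope_irredundant[OF d] by blast
    have "x \<in> \<Inter> F'" using F' s x(2) by (fastforce simp: h_def)
    moreover have "x \<notin> ?P" using x(1) s(1) not_less mem_cross_polytope by blast
    moreover have "?P \<subseteq> \<Inter> F'" using F' Pimg by blast
    ultimately show ?thesis unfolding aff by blast
  qed
  have "C facet_of ?P \<longleftrightarrow> (\<exists>H. H \<in> h ` ?S \<and> C = ?P \<inter> {x. ?a H \<bullet> x = 1})" for C
    by (rule facet_of_polyhedron_explicit[OF _ Pimg halfspace drop])
      (simp_all add: finite_sign_vectors)
  then have "{C. C facet_of ?P} = (\<lambda>s. {x \<in> ?P. s \<bullet> x = 1}) ` ?S"
    using a_h by (fastforce simp: Int_def)
  moreover have "inj_on (\<lambda>s. {x \<in> ?P. s \<bullet> x = 1}) ?S"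
  proof (rule inj_onI)
    fix s t assume st: "s \<in> ?S" "t \<in> ?S"
      and eq: "{x \<in> ?P. s \<bullet> x = 1} = {x \<in> ?P. t \<bullet> x = 1}"
    show "s = t"
      unfolding vec_eq_iff
    proof
      fix k
      \<comment> \<open>The vertex s_k e_k lies on the facet of \<open>s\<close>; lying also on that
        of \<open>t\<close> forces agreement in coordinate k.\<close>
      have "s $ k *\<^sub>R axis k 1 \<in> ?P"
        using st(1) by (simp add: cross_polytope_l1 axis_def sign_vectors_def if_distrib cong: if_cong)
      moreover have "s \<bullet> (s $ k *\<^sub>R axis k 1) = 1"
        using sign_vectors_sq[OF st(1)] by (simp add: inner_axis)
      ultimately have "t \<bullet> (s $ k *\<^sub>R axis k 1) = 1" using eq by blast
      then have "s $ k * t $ k = 1" by (simp add: inner_axis)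
      then show "s $ k = t $ k"
        using sign_vectors_cases[OF st(1), of k] by auto
    qed
  qed
  ultimately show ?thesis by (simp add: bij_betw_def)
qed

section \<open>The objective as a sum of squares\<close>

text \<open>\<open>pos k\<close> and \<open>neg k\<close> label the antipodal vertices e_k and -e_k,
  so sums over vertices split into antipodal pairs; \<open>a j\<close> is the outer normal of facet
  \<open>j\<close>.\<close>

locale labelled_cross_polytope =
  fixes v :: "'n::finite \<Rightarrow> real^'d::finite"
    and a :: "'m::finite \<Rightarrow> real^'d"
    and pos neg :: "'d \<Rightarrow> 'n"
  assumes v_pos: "v (pos k) = axis k 1"
    and v_neg: "v (neg k) = - axis k 1"
    and bij_labels: "bij_betw (case_sum pos neg) UNIV UNIV"
    and bij_a: "bij_betw a UNIV sign_vectors"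
begin

lemma sum_labels: "(\<Sum>i\<in>UNIV. f i) = (\<Sum>k\<in>UNIV. f (pos k) + f (neg k))"
  for f :: "'n \<Rightarrow> 'c::comm_monoid_add"
  using sum.reindex_bij_betw[OF bij_labels, of f] by (simp add: sum_UNIV_sum sum.distrib)

lemma label_cases:
  obtains k where "i = pos k" | k where "i = neg k"
proof -
  have "i \<in> case_sum pos neg ` UNIV" using bij_labels by (simp add: bij_betw_def)
  then obtain q where "i = case_sum pos neg q" by blast
  then show thesis using that by (cases q) auto
qed

lemma card_labels: "CARD('n) = 2 * CARD('d)"
  using sum_labels[of "\<lambda>_. 1 :: nat"] by simp

lemma card_facets: "CARD('m) = 2 ^ CARD('d)"
  using bij_betw_same_card[OF bij_a] by (simp add: card_sign_vectors)

lemma a_sign: "a j \<in> sign_vectors"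
  using bij_a by (auto simp: bij_betw_def)

lemma sum_a_orthogonal:
  "(\<Sum>j\<in>UNIV. a j $ k * a j $ l) = (if k = l then real CARD('m) else 0)"
  unfolding sum.reindex_bij_betw[OF bij_a, of "\<lambda>s. s $ k * s $ l"] sum_sign_vectors_orthogonal card_facets
  by simp

lemma a_inner_cases: "a j \<bullet> v i = 1 \<or> a j \<bullet> v i = -1"
  using sign_vectors_cases[OF a_sign]
  by (cases i rule: label_cases) (auto simp: v_pos v_neg inner_axis)

lemma v_inner_self: "v i \<bullet> v i = 1"
  by (cases i rule: label_cases) (auto simp: v_pos v_neg inner_axis)

lemma a_inner_self: "a j \<bullet> a j = real CARD('d)"
  by (simp add: inner_vec_def sign_vectors_sq[OF a_sign])

end

text \<open>Only semidefinite, since a feasible matrix may be singular: a vector of square zero need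
  not be zero.\<close>

locale psd_form =
  fixes b :: "'v::real_vector \<Rightarrow> 'v \<Rightarrow> real"
  assumes bilinear: "bilinear b"
    and commute: "b x y = b y x"
    and nonneg: "0 \<le> b x x"
begin

lemmas expand = bilinear_ladd[OF bilinear] bilinear_radd[OF bilinear]
  bilinear_lsub[OF bilinear] bilinear_rsub[OF bilinear]
  bilinear_lmul[OF bilinear, unfolded real_scaleR_def] bilinear_rmul[OF bilinear, unfolded real_scaleR_def]

lemma sum_left: "b (\<Sum>i\<in>I. f i) y = (\<Sum>i\<in>I. b (f i) y)"
  using bilinear by (intro linear_sum[where f = "\<lambda>x. b x y"]) (simp add: bilinear_def)

lemma sum_right: "b x (\<Sum>i\<in>I. f i) = (\<Sum>i\<in>I. b x (f i))"
  using bilinear by (intro linear_sum[where f = "b x"]) (simp add: bilinear_def)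

text \<open>The degenerate case of Cauchy-Schwarz. It allows a vector of square zero to be dropped
  from every product.\<close>

lemma isotropic_imp_radical:
  assumes "b x x = 0"
  shows "b x y = 0"
proof (rule ccontr)
  assume ne: "b x y \<noteq> 0"
  \<comment> \<open>With b(x,x) = 0 the square of y + t x is affine in \<open>t\<close>; this
    \<open>t\<close> makes it -1.\<close>
  define t where "t = - (b y y + 1) / (2 * b x y)"
  have "b (y + t *\<^sub>R x) (y + t *\<^sub>R x) = b y y + 2 * t * b x y"
    using assms commute[of y x] by (simp add: expand)
  also have "\<dots> = -1" using ne by (simp add: t_def field_simps)
  finally show False using nonneg[of "y + t *\<^sub>R x"] by simp
qed

end

text \<open>
  Here u, w i and z j are vectors whose b-Gram matrix is a feasible matrix of the program;
  at the optimum they become (1, 0), (1, v i) and (1, - a j).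
\<close>

locale feasible_gram = labelled_cross_polytope v a pos neg + psd_form b
  for v :: "'n::finite \<Rightarrow> real^'d::finite" and a :: "'m::finite \<Rightarrow> real^'d" and pos neg
    and b :: "'v::real_vector \<Rightarrow> 'v \<Rightarrow> real" +
  fixes u :: 'v and w :: "'n \<Rightarrow> 'v" and z :: "'m \<Rightarrow> 'v"
  assumes uu: "b u u = 1"
    and uw: "b u (w i) = 1"
    and uz: "b u (z j) = 1"
    and ww: "b (w i) (w i) = 2"
    and wz: "a j \<bullet> v i = 1 \<Longrightarrow> b (w i) (z j) = 0"
begin

text \<open>The y_k of the overview; at the optimum it becomes (0, e_k), while both defects below
  become zero.\<close>

definition half_diff :: "'d \<Rightarrow> 'v" where
  "half_diff k = (1/2) *\<^sub>R (w (pos k) - w (neg k))"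

definition mid_defect :: "'d \<Rightarrow> 'v" where
  "mid_defect k = (1/2) *\<^sub>R (w (pos k) + w (neg k)) - u"

definition facet_defect :: "'m \<Rightarrow> 'v" where
  "facet_defect j = z j - u + (\<Sum>k\<in>UNIV. a j $ k *\<^sub>R half_diff k)"

section \<open>Completing the square\<close>

lemma u_half_diff: "b u (half_diff k) = 0"
  by (simp add: half_diff_def expand uw)

text \<open>By the parallelogram law the squares of half difference and midpoint add up to 2;
  subtracting \<open>u\<close> from the midpoint lowers its square by 1.\<close>

lemma half_diff_norm: "b (half_diff k) (half_diff k) = 1 - b (mid_defect k) (mid_defect k)"
  by (simp add: half_diff_def mid_defect_def expand uw uu ww commute[of "w _" u]
      commute[of "w (neg k)" "w (pos k)"] field_simps)

text \<open>The weight -(a_j . v_i) is 1 off the facet, and on the facet the entry vanishes by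
  \<open>wz\<close>. The sum thus extends to all vertices, where antipodal pairs combine into half
  differences.\<close>

lemma slack_sum:
  "(\<Sum>i | a j \<bullet> v i \<noteq> 1. b (w i) (z j)) = - 2 * (\<Sum>k\<in>UNIV. a j $ k * b (half_diff k) (z j))"
proof -
  have "(\<Sum>i | a j \<bullet> v i \<noteq> 1. b (w i) (z j)) = (\<Sum>i | a j \<bullet> v i \<noteq> 1. - (a j \<bullet> v i) * b (w i) (z j))"
    using a_inner_cases by (intro sum.cong) (auto, force)
  also have "\<dots> = (\<Sum>i\<in>UNIV. - (a j \<bullet> v i) * b (w i) (z j))"
    by (rule sum.mono_neutral_left) (auto simp: wz)
  also have "\<dots> = - 2 * (\<Sum>k\<in>UNIV. a j $ k * b (half_diff k) (z j))"
    unfolding sum_labels sum_distrib_left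
    by (rule sum.cong) (simp_all add: v_pos v_neg inner_axis half_diff_def expand algebra_simps)
  finally show ?thesis .
qed

text \<open>Expanding the square, \<open>u\<close> is orthogonal to the combination of half
  differences, and twice its product with \<open>z j\<close> is minus the slack sum.\<close>

lemma facet_defect_norm:
  "b (facet_defect j) (facet_defect j) =
     b (z j) (z j) - (\<Sum>i | a j \<bullet> v i \<noteq> 1. b (w i) (z j)) - 1
     + (\<Sum>k\<in>UNIV. \<Sum>l\<in>UNIV. a j $ k * a j $ l * b (half_diff k) (half_diff l))"
proof -
  let ?D = "\<Sum>k\<in>UNIV. a j $ k *\<^sub>R half_diff k"
  have "b ?D u = 0" "b ?D (z j) = (\<Sum>k\<in>UNIV. a j $ k * b (half_diff k) (z j))"
    by (simp_all add: sum_left expand commute[of "half_diff _" u] u_half_diff)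
  moreover have "b ?D ?D = (\<Sum>k\<in>UNIV. \<Sum>l\<in>UNIV. a j $ k * a j $ l * b (half_diff k) (half_diff l))"
    by (simp add: sum_left sum_right[of "half_diff _"] expand sum_distrib_left mult.assoc)
  moreover have "b u ?D = b ?D u" "b (z j) ?D = b ?D (z j)" "b (z j) u = b u (z j)"
    by (rule commute)+
  ultimately show ?thesis
    unfolding slack_sum by (simp add: facet_defect_def expand uu uz)
qed

text \<open>Summing over all sign vectors kills the mixed products of the half differences.\<close>

lemma objective_sum_of_squares:
  "(\<Sum>j\<in>UNIV. b (z j) (z j) - (\<Sum>i | a j \<bullet> v i \<noteq> 1. b (w i) (z j))) =
     real CARD('m) * (1 - real CARD('d))
     + (\<Sum>j\<in>UNIV. b (facet_defect j) (facet_defect j))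
     + real CARD('m) * (\<Sum>k\<in>UNIV. b (mid_defect k) (mid_defect k))"
proof -
  \<comment> \<open>Moves the sum over facets innermost, where orthogonality of the coordinates of
    \<open>a\<close> applies.\<close>
  have "(\<Sum>j\<in>UNIV. \<Sum>k\<in>UNIV. \<Sum>l\<in>UNIV. a j $ k * a j $ l * b (half_diff k) (half_diff l))
      = (\<Sum>k\<in>UNIV. \<Sum>l\<in>UNIV. (\<Sum>j\<in>UNIV. a j $ k * a j $ l) * b (half_diff k) (half_diff l))"
    by (subst sum.swap, rule sum.cong[OF refl], subst sum.swap) (simp add: sum_distrib_right)
  also have "\<dots> = (\<Sum>k\<in>UNIV. real CARD('m) * b (half_diff k) (half_diff k))"
    by (simp add: sum_a_orthogonal if_distrib[of "\<lambda>c. c * _"] cong: if_cong)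
  finally have mixed: "(\<Sum>j\<in>UNIV. \<Sum>k\<in>UNIV. \<Sum>l\<in>UNIV. a j $ k * a j $ l * b (half_diff k) (half_diff l))
      = real CARD('m) * (real CARD('d) - (\<Sum>k\<in>UNIV. b (mid_defect k) (mid_defect k)))"
    by (simp add: half_diff_norm sum_subtractf sum_distrib_left[symmetric])
  have "b (z j) (z j) - (\<Sum>i | a j \<bullet> v i \<noteq> 1. b (w i) (z j)) = 1 + b (facet_defect j) (facet_defect j)
      - (\<Sum>k\<in>UNIV. \<Sum>l\<in>UNIV. a j $ k * a j $ l * b (half_diff k) (half_diff l))" for j
    by (simp add: facet_defect_norm)
  then show ?thesis
    by (simp only: sum.distrib sum_subtractf mixed) (simp add: algebra_simps)
qed

section \<open>The lower bound and its equality case\<close>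

lemma objective_lower_bound:
  "real CARD('m) * (1 - real CARD('d)) \<le> (\<Sum>j\<in>UNIV. b (z j) (z j) - (\<Sum>i | a j \<bullet> v i \<noteq> 1. b (w i) (z j)))"
  unfolding objective_sum_of_squares by (simp add: nonneg sum_nonneg)

text \<open>At equality all defects have square zero and so lie in the radical. Inside
  \<open>b\<close> every \<open>w i\<close> and \<open>z j\<close> is then a combination of
  \<open>u\<close> and the half differences, whose Gram matrix remains to be found.\<close>

lemma optimal_gram:
  assumes opt: "(\<Sum>j\<in>UNIV. b (z j) (z j) - (\<Sum>i | a j \<bullet> v i \<noteq> 1. b (w i) (z j)))
      = real CARD('m) * (1 - real CARD('d))"
  shows "b (w i) (w i') = 1 + v i \<bullet> v i'"
    and "b (w i) (z j) = 1 - v i \<bullet> a j"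
    and "b (z j) (z j') = 1 + a j \<bullet> a j'"
proof -
  have facet_nonneg: "0 \<le> (\<Sum>j\<in>UNIV. b (facet_defect j) (facet_defect j))"
    and mid_nonneg: "0 \<le> (\<Sum>k\<in>UNIV. b (mid_defect k) (mid_defect k))"
    by (simp_all add: nonneg sum_nonneg)
  have "(\<Sum>j\<in>UNIV. b (facet_defect j) (facet_defect j))
      + real CARD('m) * (\<Sum>k\<in>UNIV. b (mid_defect k) (mid_defect k)) = 0"
    using opt unfolding objective_sum_of_squares by simp
  then have "(\<Sum>j\<in>UNIV. b (facet_defect j) (facet_defect j)) = 0"
    and "(\<Sum>k\<in>UNIV. b (mid_defect k) (mid_defect k)) = 0"
    using facet_nonneg mid_nonneg by (simp_all add: add_nonneg_eq_0_iff)
  then have facet0: "b (facet_defect j) (facet_defect j) = 0"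
    and mid0: "b (mid_defect k) (mid_defect k) = 0" for j k
    by (simp_all add: sum_nonneg_eq_0_iff nonneg)
  have w_pos: "b (w (pos k)) x = b u x + b (half_diff k) x" for k x
    using isotropic_imp_radical[OF mid0, of k x]
    by (simp add: mid_defect_def half_diff_def expand field_simps)
  have w_neg: "b (w (neg k)) x = b u x - b (half_diff k) x" for k x
    using isotropic_imp_radical[OF mid0, of k x]
    by (simp add: mid_defect_def half_diff_def expand field_simps)
  have z_expand: "b (z j) x = b u x - (\<Sum>k\<in>UNIV. a j $ k * b (half_diff k) x)" for j x
  proof -
    have "z j = u - (\<Sum>k\<in>UNIV. a j $ k *\<^sub>R half_diff k) + facet_defect j"
      by (simp add: facet_defect_def)
    then have "b (z j) x = b (u - (\<Sum>k\<in>UNIV. a j $ k *\<^sub>R half_diff k) + facet_defect j) x"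
      by (rule arg_cong)
    then show ?thesis
      using isotropic_imp_radical[OF facet0] by (simp add: expand sum_left)
  qed
  have half_z: "b (half_diff k) (z j) = - (\<Sum>l\<in>UNIV. a j $ l * b (half_diff k) (half_diff l))" for k j
    using z_expand[of j "half_diff k"] by (simp add: commute[of "half_diff k"] u_half_diff)
  \<comment> \<open>One of the two vertices of pair k lies on facet j, and its zero slack gives this
    equation: the Gram matrix of the half differences fixes every \<open>a j\<close>.\<close>
  have on_facet: "(\<Sum>l\<in>UNIV. a j $ l * b (half_diff k) (half_diff l)) = a j $ k" for j k
  proof -
    consider "a j $ k = 1" | "a j $ k = -1" using sign_vectors_cases[OF a_sign] by blast
    then show ?thesis
    proof cases
      case 1
      then have "b (w (pos k)) (z j) = 0" by (intro wz) (simp add: v_pos inner_axis)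
      then show ?thesis using 1 by (simp add: w_pos uz half_z)
    next
      case 2
      then have "b (w (neg k)) (z j) = 0" by (intro wz) (simp add: v_neg inner_axis)
      then show ?thesis using 2 by (simp add: w_neg uz half_z)
    qed
  qed
  \<comment> \<open>Multiplying \<open>on_facet\<close> by coordinate \<open>m\<close> of
    \<open>a j\<close> and summing over all facets isolates a single Gram entry; the common factor
    \<open>CARD('m)\<close> cancels.\<close>
  have half_half: "b (half_diff k) (half_diff m) = (if k = m then 1 else 0)" for k m
  proof -
    have "(\<Sum>j\<in>UNIV. a j $ k * a j $ m)
        = (\<Sum>j\<in>UNIV. \<Sum>l\<in>UNIV. a j $ l * a j $ m * b (half_diff k) (half_diff l))"
    proof (rule sum.cong[OF refl])
      fix j
      have "a j $ k * a j $ m = (\<Sum>l\<in>UNIV. a j $ l * b (half_diff k) (half_diff l)) * a j $ m"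
        by (simp only: on_facet)
      also have "\<dots> = (\<Sum>l\<in>UNIV. a j $ l * a j $ m * b (half_diff k) (half_diff l))"
        unfolding sum_distrib_right by (simp add: mult_ac)
      finally show "a j $ k * a j $ m = (\<Sum>l\<in>UNIV. a j $ l * a j $ m * b (half_diff k) (half_diff l))" .
    qed
    also have "\<dots> = (\<Sum>l\<in>UNIV. (\<Sum>j\<in>UNIV. a j $ l * a j $ m) * b (half_diff k) (half_diff l))"
      by (subst sum.swap) (simp add: sum_distrib_right)
    also have "\<dots> = real CARD('m) * b (half_diff k) (half_diff m)"
      by (simp add: sum_a_orthogonal if_distrib[of "\<lambda>c. c * _"] cong: if_cong)
    finally show ?thesis by (simp add: sum_a_orthogonal split: if_splits)
  qed
  have half_z': "b (half_diff k) (z j) = - a j $ k" for k j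
    by (simp add: half_z on_facet)
  have half_w: "b (half_diff k) (w i) = v i $ k" for k i
  proof -
    have "b (w i) (half_diff k) = v i $ k"
      by (cases i rule: label_cases)
        (simp_all add: w_pos w_neg u_half_diff half_half v_pos v_neg axis_def)
    then show ?thesis by (subst commute)
  qed
  show "b (w i) (w i') = 1 + v i \<bullet> v i'"
    by (cases i rule: label_cases) (simp_all add: w_pos w_neg v_pos v_neg uw half_w inner_axis')
  show "b (w i) (z j) = 1 - v i \<bullet> a j"
    by (cases i rule: label_cases) (simp_all add: w_pos w_neg v_pos v_neg uz half_z' inner_axis')
  show "b (z j) (z j') = 1 + a j \<bullet> a j'"
    by (simp add: z_expand[of j] uz half_z' inner_vec_def sum_negf)
qed

end

section \<open>The optimal matrix\<close>

lemma psd_form_of_psd: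
  assumes "psd M"
  shows "psd_form (\<lambda>x y. x \<bullet> (M *v y))"
proof
  show "bilinear (\<lambda>x y. x \<bullet> (M *v y))"
    by (auto simp: bilinear_def matrix_vector_right_distrib inner_left_distrib inner_right_distrib
        matrix_vector_mult_scaleR intro!: linearI)
  show "x \<bullet> (M *v y) = y \<bullet> (M *v x)" for x y
    using assms dot_lmul_matrix[of y M x] unfolding psd_def
    by (metis inner_commute transpose_matrix_vector)
  show "0 \<le> x \<bullet> (M *v x)" for x using assms by (simp add: psd_def)
qed

section \<open>Gram matrices and their rank\<close>

lemma inner_axis_matrix_axis: "axis p (1::real) \<bullet> (M *v axis q 1) = M $ p $ q"
  by (simp add: inner_axis' column_def matrix_vector_mult_basis)

lemma psd_gram: "psd (G ** transpose G)"
  unfolding psd_def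
proof (intro conjI allI)
  show "transpose (G ** transpose G) = G ** transpose G"
    by (simp add: matrix_transpose_mul transpose_transpose)
  fix x
  have "x \<bullet> ((G ** transpose G) *v x) = (transpose G *v x) \<bullet> (transpose G *v x)"
    by (metis dot_lmul_matrix matrix_vector_mul_assoc transpose_matrix_vector)
  then show "0 \<le> x \<bullet> ((G ** transpose G) *v x)" by simp
qed

text \<open>A left inverse \<open>H\<close> of \<open>G\<close> turns the Gram matrix into the
  identity by multiplication on both sides, and multiplication cannot raise the rank.\<close>

lemma rank_gram:
  fixes G :: "real^'k^'p"
  assumes "inj ((*v) G)"
  shows "rank (G ** transpose G) = CARD('k)"
proof (rule antisym)
  show "rank (G ** transpose G) \<le> CARD('k)"
    using rank_mul_le_left[of G "transpose G"] rank_bound[of G] by linarith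
  obtain H :: "real^'p^'k" where H: "H ** G = mat 1"
    using assms matrix_left_invertible_injective[of G] by blast
  have "transpose G ** transpose H = mat 1"
    using arg_cong[OF H, of transpose] by (simp add: matrix_transpose_mul transpose_mat)
  then have "H ** (G ** transpose G) ** transpose H = mat 1"
    by (metis H matrix_mul_assoc matrix_mul_lid)
  then have "CARD('k) = rank (H ** (G ** transpose G) ** transpose H)"
    by (simp add: rank_I)
  also have "\<dots> \<le> rank (G ** transpose G)"
    using rank_mul_le_left rank_mul_le_right order_trans by blast
  finally show "CARD('k) \<le> rank (G ** transpose G)" .
qed

text \<open>Homogenization: \<open>None\<close> is the extra coordinate, fixed at 1.\<close>

definition lift1 :: "real^'d \<Rightarrow> real^('d option)" where
  "lift1 x = (\<chi> p. case p of None \<Rightarrow> 1 | Some k \<Rightarrow> x $ k)"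

lemma inner_lift1: "lift1 x \<bullet> lift1 y = 1 + x \<bullet> y" for x y :: "real^'d::finite"
  by (simp add: inner_vec_def sum_UNIV_option lift1_def)

section \<open>The candidate optimum and the program\<close>

context labelled_cross_polytope
begin

text \<open>Rows (1,0), (1,v_i) and (1,-a_j); the minus sign makes the mixed products the slacks 1 -
  v_i . a_j.\<close>

definition gram_factor :: "real^('d option)^(('n + 'm) option)" where
  "gram_factor = (\<chi> p. lift1 (case_option 0 (case_sum v (\<lambda>j. - a j)) p))"

definition opt_A :: "real^'n^'n" where "opt_A = (\<chi> i i'. 1 + v i \<bullet> v i')"
definition opt_S :: "real^'m^'n" where "opt_S = (\<chi> i j. 1 - v i \<bullet> a j)"
definition opt_B :: "real^'m^'m" where "opt_B = (\<chi> j j'. 1 + a j \<bullet> a j')"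

lemma sdp_matrix_opt: "sdp_matrix opt_A opt_S opt_B = gram_factor ** transpose gram_factor"
proof -
  have "sdp_entry opt_A opt_S opt_B p q = gram_factor $ p \<bullet> gram_factor $ q" for p q
    by (cases "(opt_A, opt_S, opt_B, p, q)" rule: sdp_entry.cases)
      (simp_all add: gram_factor_def inner_lift1 opt_A_def opt_S_def opt_B_def transpose_def inner_commute)
  then show ?thesis
    by (simp add: vec_eq_iff sdp_matrix_def matrix_matrix_mult_def transpose_def inner_vec_def)
qed

text \<open>The rows (1,0) and (1,e_k) already determine all coordinates of
  \<open>x\<close>.\<close>

lemma inj_gram_factor: "inj ((*v) gram_factor)"
proof -
  have "x = 0" if "gram_factor *v x = 0" for x
  proof -
    have eq: "gram_factor $ p \<bullet> x = 0" for p
      using that by (metis matrix_vector_mul_component zero_index)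
    have x0: "x $ None = 0"
      using eq[of None] by (simp add: gram_factor_def lift1_def inner_vec_def sum_UNIV_option)
    have "x $ Some k = 0" for k
      using eq[of "Some (Inl (pos k))"] x0
      by (simp add: gram_factor_def lift1_def inner_vec_def sum_UNIV_option v_pos axis_def
          if_distrib[of "\<lambda>c. c * _"] cong: if_cong)
    with x0 show "x = 0" by (metis (no_types) not_None_eq vec_eq_iff zero_index)
  qed
  then show ?thesis using matrix_left_invertible_injective matrix_left_invertible_ker by blast
qed

lemma rank_opt: "rank (sdp_matrix opt_A opt_S opt_B) = CARD('d) + 1"
  unfolding sdp_matrix_opt rank_gram[OF inj_gram_factor] by (simp add: card_UNIV_option)

definition on_facet_pairs :: "('n \<times> 'm) set" where
  "on_facet_pairs = {(i, j). a j \<bullet> v i = 1}"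

lemma opt_feasible: "sdp_feasible on_facet_pairs opt_A opt_S opt_B"
  unfolding sdp_feasible_def on_facet_pairs_def
  by (auto simp: sdp_matrix_opt psd_gram)
    (auto simp: opt_A_def opt_S_def opt_B_def transpose_def vec_eq_iff inner_commute v_inner_self)

text \<open>A psd matrix is the Gram matrix of the standard basis under its own form, so no
  factorization has to be chosen.\<close>

lemma feasible_gramI:
  assumes "sdp_feasible on_facet_pairs A S B"
  shows "feasible_gram v a pos neg (\<lambda>x y. x \<bullet> (sdp_matrix A S B *v y)) (axis None 1)
    (\<lambda>i. axis (Some (Inl i)) 1) (\<lambda>j. axis (Some (Inr j)) 1)"
proof -
  interpret psd_form "\<lambda>x y. x \<bullet> (sdp_matrix A S B *v y)"
    using assms by (intro psd_form_of_psd) (simp add: sdp_feasible_def)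
  show ?thesis
    using assms
    by unfold_locales (auto simp: inner_axis_matrix_axis sdp_matrix_def sdp_feasible_def on_facet_pairs_def)
qed

text \<open>Feasibility fixes the leading entry and the diagonal of \<open>A\<close>; what varies is
  grouped by facet to match the sum of squares.\<close>

lemma sdp_objective_feasible:
  assumes feas: "sdp_feasible on_facet_pairs A S B"
    and lam: "\<forall>i j. (i, j) \<notin> on_facet_pairs \<longrightarrow> lam i j = 1"
  shows "sdp_objective on_facet_pairs lam A S B
    = 1 + 2 * real CARD('n) + (\<Sum>j\<in>UNIV. B $ j $ j - (\<Sum>i | a j \<bullet> v i \<noteq> 1. S $ i $ j))"
proof -
  have "trace (sdp_matrix A S B) = 1 + 2 * real CARD('n) + (\<Sum>j\<in>UNIV. B $ j $ j)"
    using feas by (simp add: trace_def sum_UNIV_option sum_UNIV_sum sdp_matrix_def sdp_feasible_def)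
  moreover have "(\<Sum>(i, j)\<in>- on_facet_pairs. lam i j * S $ i $ j)
      = (\<Sum>(j, i)\<in>(SIGMA j:UNIV. {i. a j \<bullet> v i \<noteq> 1}). S $ i $ j)"
    by (rule sum.reindex_bij_witness[where i = prod.swap and j = prod.swap])
      (use lam in \<open>auto simp: on_facet_pairs_def\<close>)
  ultimately show ?thesis
    by (simp add: sdp_objective_def sum.Sigma[symmetric] sum_subtractf)
qed

text \<open>The candidate attains the lower bound: each facet contributes (1 + d) - 2d, as the inner
  products of antipodal vertices with \<open>a j\<close> cancel.\<close>

lemma opt_objective:
  "(\<Sum>j\<in>UNIV. opt_B $ j $ j - (\<Sum>i | a j \<bullet> v i \<noteq> 1. opt_S $ i $ j))
     = real CARD('m) * (1 - real CARD('d))"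
proof -
  have "(\<Sum>i | a j \<bullet> v i \<noteq> 1. opt_S $ i $ j) = 2 * real CARD('d)" for j
  proof -
    have "(\<Sum>i | a j \<bullet> v i \<noteq> 1. opt_S $ i $ j) = (\<Sum>i\<in>UNIV. 1 - a j \<bullet> v i)"
      by (rule sum.mono_neutral_cong_left) (auto simp: opt_S_def inner_commute)
    also have "\<dots> = 2 * real CARD('d)"
      by (simp add: sum_labels v_pos v_neg)
    finally show ?thesis .
  qed
  then show ?thesis by (simp add: opt_B_def a_inner_self)
qed

lemma sdp_optimal_opt:
  assumes lam: "\<forall>i j. (i, j) \<notin> on_facet_pairs \<longrightarrow> lam i j = 1"
  shows "sdp_optimal on_facet_pairs lam opt_A opt_S opt_B"
  unfolding sdp_optimal_def
proof (intro conjI allI impI opt_feasible)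
  fix A S B assume feas: "sdp_feasible on_facet_pairs A S B"
  interpret feasible_gram v a pos neg "\<lambda>x y. x \<bullet> (sdp_matrix A S B *v y)" "axis None 1"
    "\<lambda>i. axis (Some (Inl i)) 1" "\<lambda>j. axis (Some (Inr j)) 1"
    using feas by (rule feasible_gramI)
  show "sdp_objective on_facet_pairs lam opt_A opt_S opt_B \<le> sdp_objective on_facet_pairs lam A S B"
    using objective_lower_bound
    by (simp add: sdp_objective_feasible[OF feas lam] sdp_objective_feasible[OF opt_feasible lam]
        opt_objective inner_axis_matrix_axis sdp_matrix_def)
qed

text \<open>An optimal value cannot exceed that of the candidate, which meets the lower bound, so
  the equality case applies.\<close>

lemma sdp_optimal_unique:
  assumes lam: "\<forall>i j. (i, j) \<notin> on_facet_pairs \<longrightarrow> lam i j = 1"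
    and opt: "sdp_optimal on_facet_pairs lam A S B"
  shows "A $ i $ i' = 1 + v i \<bullet> v i'" "S $ i $ j = 1 - v i \<bullet> a j" "B $ j $ j' = 1 + a j \<bullet> a j'"
proof -
  have feas: "sdp_feasible on_facet_pairs A S B"
    and le: "sdp_objective on_facet_pairs lam A S B \<le> sdp_objective on_facet_pairs lam opt_A opt_S opt_B"
    using opt opt_feasible by (auto simp: sdp_optimal_def)
  interpret feasible_gram v a pos neg "\<lambda>x y. x \<bullet> (sdp_matrix A S B *v y)" "axis None 1"
    "\<lambda>i. axis (Some (Inl i)) 1" "\<lambda>j. axis (Some (Inr j)) 1"
    using feas by (rule feasible_gramI)
  have "(\<Sum>j\<in>UNIV. B $ j $ j - (\<Sum>i | a j \<bullet> v i \<noteq> 1. S $ i $ j)) = real CARD('m) * (1 - real CARD('d))"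
    using le objective_lower_bound
    by (simp add: sdp_objective_feasible[OF feas lam] sdp_objective_feasible[OF opt_feasible lam]
        opt_objective inner_axis_matrix_axis sdp_matrix_def)
  then show "A $ i $ i' = 1 + v i \<bullet> v i'" "S $ i $ j = 1 - v i \<bullet> a j" "B $ j $ j' = 1 + a j \<bullet> a j'"
    using optimal_gram by (simp_all add: inner_axis_matrix_axis sdp_matrix_def)
qed

end

section \<open>Inscribed realization and coordinates for a given labelling\<close>

lemma face_lattice_iso_id: "face_lattice_iso id P P"
  by (simp add: face_lattice_iso_def)

lemma polytope_cross_polytope: "polytope (cross_polytope :: (real^'d::finite) set)"
  unfolding polytope_def cross_polytope_def
  by (rule exI[of _ "range (\<lambda>k. axis k 1) \<union> range (\<lambda>k. - axis k 1)"]) simp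

lemma inscribed_cross_polytope: "inscribed (cross_polytope :: (real^'d::finite) set)"
  unfolding inscribed_def extreme_points_cross_polytope
  by (intro exI[of _ 0] exI[of _ 1]) auto

lemma labelled_cross_polytope_exists:
  fixes v :: "'n::finite \<Rightarrow> real^'d::finite" and F :: "'m::finite \<Rightarrow> (real^'d) set"
  assumes d: "2 \<le> CARD('d)"
    and v: "bij_betw v UNIV {x. x extreme_point_of (cross_polytope :: (real^'d) set)}"
    and F: "bij_betw F UNIV {G. G facet_of (cross_polytope :: (real^'d) set)}"
  obtains a pos neg where "labelled_cross_polytope v a pos neg"
    and "\<And>j. F j = {x \<in> cross_polytope. a j \<bullet> x = 1}"
proof -
  let ?f = "\<lambda>s :: real^'d. {x \<in> cross_polytope. s \<bullet> x = 1}"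
  let ?V = "{x :: real^'d. x extreme_point_of cross_polytope}"
  note f = facets_cross_polytope[OF d]
  \<comment> \<open>\<open>a j\<close> is the unique sign vector whose supporting hyperplane cuts
    out \<open>F j\<close>.\<close>
  define a where "a = inv_into sign_vectors ?f \<circ> F"
  define pos where "pos k = inv v (axis k 1)" for k
  define neg where "neg k = inv v (- axis k 1)" for k
  have a: "bij_betw a UNIV sign_vectors"
    unfolding a_def using F bij_betw_inv_into[OF f] by (rule bij_betw_trans)
  have v_inv: "v (inv v x) = x" if "x \<in> ?V" for x
    using v that by (simp add: bij_betw_inv_into_right)
  have v_pos: "v (pos k) = axis k 1" and v_neg: "v (neg k) = - axis k 1" for k
    using extreme_points_cross_polytope[where 'd = 'd] by (auto simp: pos_def neg_def intro!: v_inv)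
  have "bij_betw (case_sum pos neg) UNIV UNIV"
    unfolding bij_betw_def
  proof
    have "inj (v \<circ> case_sum pos neg)"
      by (auto simp: inj_on_def v_pos v_neg axis_eq_axis vec_eq_iff axis_def
          split: sum.splits if_splits)
    then show "inj (case_sum pos neg)" by (rule inj_on_imageI2)
    have "i \<in> range (case_sum pos neg)" for i
    proof -
      have "inj v" using v by (simp add: bij_betw_def)
      have "v i \<in> ?V" using v by (auto simp: bij_betw_def)
      then obtain k where "v i = v (pos k) \<or> v i = v (neg k)"
        by (auto simp: extreme_points_cross_polytope v_pos v_neg)
      then have "i = case_sum pos neg (Inl k) \<or> i = case_sum pos neg (Inr k)"
        using \<open>inj v\<close> by (auto dest: injD)
      then show ?thesis by blast
    qed
    then show "range (case_sum pos neg) = UNIV" by blast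
  qed
  moreover have "F j = ?f (a j)" for j
    using bij_betw_inv_into_right[OF f] F by (auto simp: a_def bij_betw_def)
  ultimately show thesis
    using that[of a pos neg] a v_pos v_neg by (simp add: labelled_cross_polytope_def)
qed

theorem theorem5:
  fixes v :: "'n::finite \<Rightarrow> real^'d::finite"
    and F :: "'m::finite \<Rightarrow> (real^'d) set"
    and Iz :: "('n \<times> 'm) set"
    and lam :: "'n \<Rightarrow> 'm \<Rightarrow> real"
  assumes "2 \<le> CARD('d)"
    and "bij_betw v UNIV {x. x extreme_point_of (cross_polytope :: (real^'d) set)}"
    and "bij_betw F UNIV {G. G facet_of (cross_polytope :: (real^'d) set)}"
    and "Iz = {(i, j). v i \<in> F j}"
    and "\<forall>i j. (i, j) \<notin> Iz \<longrightarrow> lam i j = 1"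
  shows "CARD('n) = 2 * CARD('d) \<and> CARD('m) = 2 ^ CARD('d) \<and>
    (\<exists>A S B. sdp_optimal Iz lam A S B \<and>
       rank (sdp_matrix A S B) = CARD('d) + 1 \<and>
       (\<forall>i j. (i, j) \<notin> Iz \<longrightarrow> 0 < S $ i $ j)) \<and>
    (\<forall>A S B. sdp_optimal Iz lam A S B \<and>
       rank (sdp_matrix A S B) = CARD('d) + 1 \<and>
       (\<forall>i j. (i, j) \<notin> Iz \<longrightarrow> 0 < S $ i $ j) \<longrightarrow>
       certifies_inscribability (cross_polytope :: (real^'d) set) v F A S B) \<and>
    inscribable (cross_polytope :: (real^'d) set)"
proof -
  obtain a pos neg where "labelled_cross_polytope v a pos neg"
    and F: "\<And>j. F j = {x \<in> cross_polytope. a j \<bullet> x = 1}"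
    using labelled_cross_polytope_exists[OF assms(1-3)] by metis
  then interpret labelled_cross_polytope v a pos neg by simp
  \<comment> \<open>Since vertices lie in the polytope, membership in \<open>F j\<close> reduces to
    the tight equation, identifying \<open>Iz\<close> with \<open>on_facet_pairs\<close>.\<close>
  have "v i \<in> cross_polytope" for i
    using assms(2) by (auto simp: bij_betw_def extreme_point_of_def)
  then have Iz: "Iz = on_facet_pairs"
    by (auto simp: assms(4) F on_facet_pairs_def)
  then have lam: "\<forall>i j. (i, j) \<notin> on_facet_pairs \<longrightarrow> lam i j = 1"
    using assms(5) by simp
  have slack_pos: "0 < opt_S $ i $ j" if "(i, j) \<notin> Iz" for i j
    using that a_inner_cases[of j i] by (auto simp: Iz on_facet_pairs_def opt_S_def inner_commute)
  \<comment> \<open>By uniqueness any optimum is the candidate, so the cross-polytope itself serves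
    as \<open>Q\<close>, with the identity on faces.\<close>
  have cert: "certifies_inscribability (cross_polytope :: (real^'d) set) v F A S B"
    if opt: "sdp_optimal Iz lam A S B" for A S B
    unfolding certifies_inscribability_def
    using sdp_optimal_unique[OF lam opt[unfolded Iz]] a_sign
    by (intro exI[of _ cross_polytope] exI[of _ id] exI[of _ v] exI[of _ a])
      (auto simp: polytope_cross_polytope face_lattice_iso_id inscribed_cross_polytope F mem_cross_polytope)
  have "inscribable (cross_polytope :: (real^'d) set)"
    unfolding inscribable_def combinatorially_equivalent_def
    using polytope_cross_polytope face_lattice_iso_id inscribed_cross_polytope by blast
  moreover have "\<exists>A S B. sdp_optimal Iz lam A S B \<and> rank (sdp_matrix A S B) = CARD('d) + 1 \<and>
       (\<forall>i j. (i, j) \<notin> Iz \<longrightarrow> 0 < S $ i $ j)"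
    using sdp_optimal_opt[OF lam] rank_opt slack_pos unfolding Iz by blast
  ultimately show ?thesis using card_labels card_facets cert by blast
qed

end
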